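(* For real-valued $V\in C^1(\mathbb R/\mathbb Z)$ and $h\in\mathbb R$ let $P_{\rm d}(h)$ be the selfadjoint operator on $\ell^2(\mathbb Z)$ given by $$(P_{\rm d}(h)v)(\gamma):=2v(\gamma)-v(\gamma+1)-v(\gamma-1)+V(h\gamma)v(\gamma),\quad\gamma\in\mathbb Z.$$ It is in general not true that the map $\mathbb R\ni h\mapsto\min\operatorname{Spec}(P_{\rm d}(h))$, let alone the map $\mathbb R\ni h\mapsto\operatorname{Spec}(P_{\rm d}(h))$, is continuous: there exist real-valued $V\in C^1(\mathbb R/\mathbb Z)$ for which these maps are discontinuous. However, for every real-valued $V\in C^1(\mathbb R/\mathbb Z)$, both maps are continuous on $\mathbb R\setminus\mathbb Q$ (that is, their restrictions to $\mathbb R\setminus\mathbb Q$ are continuous).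
   Context: Functions on $\mathbb R/\mathbb Z$ are identified with $1$-periodic functions on $\mathbb R$. Continuity of $h\mapsto\operatorname{Spec}(P_{\rm d}(h))$ is understood with respect to the Hausdorff distance on compact subsets of $\mathbb R$. *)

theory Defs
  imports "HOL-Analysis.Analysis"
begin

text \<open>The Hilbert space of square-summable functions on the integers, as a carrier set.\<close>

definition l2Z :: "(int \<Rightarrow> complex) set" where
  "l2Z = {v. (\<lambda>\<gamma>. (cmod (v \<gamma>))\<^sup>2) summable_on UNIV}"

definition l2Z_norm :: "(int \<Rightarrow> complex) \<Rightarrow> real" where
  "l2Z_norm v = sqrt (\<Sum>\<^sub>\<infinity>\<gamma>. (cmod (v \<gamma>))\<^sup>2)"

text \<open>For an operator \<open>A\<close> mapping \<open>l2Z\<close> to itself, the resolvent set consists of those \<open>z\<close>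
  for which \<open>A - z\<close> is a bijection of \<open>l2Z\<close> onto itself with bounded inverse.\<close>

definition l2Z_resolvent_set :: "((int \<Rightarrow> complex) \<Rightarrow> (int \<Rightarrow> complex)) \<Rightarrow> complex set" where
  "l2Z_resolvent_set A =
     {z. bij_betw (\<lambda>v \<gamma>. A v \<gamma> - z * v \<gamma>) l2Z l2Z \<and>
         (\<exists>C. \<forall>v\<in>l2Z. l2Z_norm v \<le> C * l2Z_norm (\<lambda>\<gamma>. A v \<gamma> - z * v \<gamma>))}"

definition l2Z_spectrum :: "((int \<Rightarrow> complex) \<Rightarrow> (int \<Rightarrow> complex)) \<Rightarrow> complex set" where
  "l2Z_spectrum A = - l2Z_resolvent_set A"

definition P_d :: "(real \<Rightarrow> real) \<Rightarrow> real \<Rightarrow> (int \<Rightarrow> complex) \<Rightarrow> (int \<Rightarrow> complex)" where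
  "P_d V h v = (\<lambda>\<gamma>. 2 * v \<gamma> - v (\<gamma> + 1) - v (\<gamma> - 1) + of_real (V (h * of_int \<gamma>)) * v \<gamma>)"

text \<open>For continuous periodic \<open>V\<close> the operator \<open>P_d V h\<close> is bounded and selfadjoint, so its
  spectrum is a nonempty compact set of real numbers; it is recorded here as a set of reals.\<close>

definition Spec_P_d :: "(real \<Rightarrow> real) \<Rightarrow> real \<Rightarrow> real set" where
  "Spec_P_d V h = {x. complex_of_real x \<in> l2Z_spectrum (P_d V h)}"

definition min_Spec_P_d :: "(real \<Rightarrow> real) \<Rightarrow> real \<Rightarrow> real" where
  "min_Spec_P_d V h = (LEAST x. x \<in> Spec_P_d V h)"

definition C1_periodic :: "(real \<Rightarrow> real) \<Rightarrow> bool" where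
  "C1_periodic V \<longleftrightarrow> V C1_differentiable_on UNIV \<and> (\<forall>x. V (x + 1) = V x)"

text \<open>Meaningful for nonempty bounded sets, where the suprema are finite.\<close>

definition hausdorff_dist :: "'a::metric_space set \<Rightarrow> 'a set \<Rightarrow> real" where
  "hausdorff_dist A B = max (SUP a\<in>A. infdist a B) (SUP b\<in>B. infdist b A)"

definition hausdorff_continuous_on ::
    "'a::topological_space set \<Rightarrow> ('a \<Rightarrow> 'b::metric_space set) \<Rightarrow> bool" where
  "hausdorff_continuous_on S F \<longleftrightarrow>
     (\<forall>h\<in>S. ((\<lambda>k. hausdorff_dist (F k) (F h)) \<longlongrightarrow> 0) (at h within S))"

end

theory Submission
  imports Defs
begin

text \<open>
  At a rational \<open>h\<close> the operator only sees the finitely many values of \<open>V\<close> on the orbit of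
  \<open>0\<close>, while for nearby \<open>h\<close> the phase \<open>h \<gamma>\<close> drifts slowly through all other values. This
  makes the spectrum jump: \<open>V x = 4 cos (2 \<pi> x)\<close> looks like the constant \<open>4\<close> at \<open>h = 0\<close>, but
  reaches \<open>-4\<close> for \<open>h = 1/(2n)\<close> (\<open>cosine_spectrum\<close>).

  At an irrational \<open>h\<close> every phase is already approximated, so nothing can jump. Let \<open>h\<close> and
  \<open>h'\<close> be irrational and close, and let \<open>z\<close> be in the spectrum at \<open>h\<close>. An approximate
  eigenfunction for \<open>z\<close> can be cut down to a window whose radius \<open>N\<close> depends only on the
  accuracy \<open>e\<close> (\<open>localised_quasimode\<close>). By density of the orbit of \<open>h'\<close> modulo 1, the potential
  in this window reappears, up to \<open>e\<close>, in some window of the operator at \<open>h'\<close>, provided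
  \<open>N |h - h'|\<close> is small. Translating the function there gives an approximate eigenfunction at
  \<open>h'\<close>, hence spectrum at \<open>h'\<close> near \<open>z\<close> (\<open>spectrum_transfer\<close>, \<open>spectra_close\<close>). The
  roles of \<open>h\<close> and \<open>h'\<close> can be exchanged, and since \<open>N\<close> does not depend on \<open>z\<close>, the two
  spectra are close in the Hausdorff distance.

  Two facts on symmetric bounded operators on a Hilbert space link approximate
  eigenfunctions with the spectrum, both proved without the spectral theorem: an operator that is
  bounded below is onto (\<open>symmetric_bounded_below_surj\<close>), and an approximate eigenfunction of
  accuracy \<open>e\<close> forces spectrum within distance \<open>e\<close> (\<open>spectrum_near_quasimode\<close>).
\<close>

section \<open>The Hilbert space of square-summable functions on the integers\<close>

lemma l2Z_cauchy_schwarz_pointwise: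
  "\<bar>x \<bullet> y\<bar> \<le> (cmod x)\<^sup>2 + (cmod y)\<^sup>2"
proof -
  have "2 * (cmod x * cmod y) \<le> (cmod x)\<^sup>2 + (cmod y)\<^sup>2"
    using sum_squares_bound[of "cmod x" "cmod y"] by (simp add: mult.assoc)
  moreover have "\<bar>x \<bullet> y\<bar> \<le> cmod x * cmod y" by (rule Cauchy_Schwarz_ineq2)
  moreover have "0 \<le> cmod x * cmod y" by simp
  ultimately show ?thesis by linarith
qed

lemma l2Z_dominated:
  assumes "u \<in> l2Z" "v \<in> l2Z"
    and "\<And>\<gamma>. (cmod (w \<gamma>))\<^sup>2 \<le> B * (cmod (u \<gamma>))\<^sup>2 + C * (cmod (v \<gamma>))\<^sup>2"
  shows "w \<in> l2Z"
proof -
  have "(\<lambda>\<gamma>. B * (cmod (u \<gamma>))\<^sup>2 + C * (cmod (v \<gamma>))\<^sup>2) summable_on UNIV"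
    using assms(1,2) unfolding l2Z_def by (intro summable_on_add summable_on_cmult_right) auto
  then have "(\<lambda>\<gamma>. (cmod (w \<gamma>))\<^sup>2) summable_on UNIV"
    by (rule summable_on_comparison_test) (use assms(3) in auto)
  then show ?thesis by (simp add: l2Z_def)
qed

lemma l2Z_zero: "(\<lambda>_. 0) \<in> l2Z"
  by (simp add: l2Z_def)

lemma cmod_add_sq_le: "(cmod (x + y))\<^sup>2 \<le> 2 * (cmod x)\<^sup>2 + 2 * (cmod y)\<^sup>2"
proof -
  have "(cmod (x + y))\<^sup>2 \<le> (cmod x + cmod y)\<^sup>2"
    by (intro power_mono norm_triangle_ineq) auto
  also have "\<dots> \<le> 2 * (cmod x)\<^sup>2 + 2 * (cmod y)\<^sup>2"
    using sum_squares_bound[of "cmod x" "cmod y"] by (simp add: power2_sum)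
  finally show ?thesis .
qed

lemma l2Z_add: "u \<in> l2Z \<Longrightarrow> v \<in> l2Z \<Longrightarrow> (\<lambda>\<gamma>. u \<gamma> + v \<gamma>) \<in> l2Z"
  by (rule l2Z_dominated[where B=2 and C=2 and u=u and v=v]) (simp_all only: cmod_add_sq_le)

lemma l2Z_mult:
  assumes "u \<in> l2Z" "\<And>\<gamma>. \<bar>g \<gamma>\<bar> \<le> B"
  shows "(\<lambda>\<gamma>. g \<gamma> *\<^sub>R u \<gamma>) \<in> l2Z"
proof (rule l2Z_dominated[OF assms(1) assms(1), where B="B\<^sup>2" and C=0])
  fix \<gamma>
  have "(g \<gamma>)\<^sup>2 \<le> B\<^sup>2" using assms(2)[of \<gamma>] by (metis abs_ge_zero power2_abs power_mono)
  then show "(cmod (g \<gamma> *\<^sub>R u \<gamma>))\<^sup>2 \<le> B\<^sup>2 * (cmod (u \<gamma>))\<^sup>2 + 0 * (cmod (u \<gamma>))\<^sup>2"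
    by (simp add: power_mult_distrib mult_right_mono)
qed

text \<open>A type makes the vector-space and norm machinery of the type classes available. Only the
  real structure is used, with inner product \<open>Re (\<Sum> u cnj v)\<close>: spectral parameters are real,
  and an operator that is symmetric for the sesquilinear product is symmetric for this one.\<close>

typedef ell2 = l2Z
  morphisms coord Abs_ell2
  using l2Z_zero by blast

setup_lifting type_definition_ell2

instantiation ell2 :: real_vector
begin
lift_definition zero_ell2 :: ell2 is "\<lambda>_. 0" by (rule l2Z_zero)
lift_definition plus_ell2 :: "ell2 \<Rightarrow> ell2 \<Rightarrow> ell2" is "\<lambda>u v \<gamma>. u \<gamma> + v \<gamma>" by (rule l2Z_add)
lift_definition uminus_ell2 :: "ell2 \<Rightarrow> ell2" is "\<lambda>u \<gamma>. - u \<gamma>" by (simp add: l2Z_def)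
lift_definition minus_ell2 :: "ell2 \<Rightarrow> ell2 \<Rightarrow> ell2" is "\<lambda>u v \<gamma>. u \<gamma> - v \<gamma>"
proof -
  fix u v :: "int \<Rightarrow> complex"
  assume "u \<in> l2Z" "v \<in> l2Z"
  then have "(\<lambda>\<gamma>. u \<gamma> + - v \<gamma>) \<in> l2Z" by (intro l2Z_add) (auto simp: l2Z_def)
  then show "(\<lambda>\<gamma>. u \<gamma> - v \<gamma>) \<in> l2Z" by simp
qed
lift_definition scaleR_ell2 :: "real \<Rightarrow> ell2 \<Rightarrow> ell2" is "\<lambda>r u \<gamma>. r *\<^sub>R u \<gamma>"
  by (rule l2Z_mult) auto
instance
  by standard (transfer; simp add: algebra_simps; fail)+
end

lemmas coord_simps [simp] = zero_ell2.rep_eq plus_ell2.rep_eq uminus_ell2.rep_eq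
  minus_ell2.rep_eq scaleR_ell2.rep_eq

lemma ell2_eqI: "(\<And>\<gamma>. coord u \<gamma> = coord v \<gamma>) \<Longrightarrow> u = v"
  by (metis coord_inject ext)

lemma summable_coord: "(\<lambda>\<gamma>. (cmod (coord u \<gamma>))\<^sup>2) summable_on UNIV"
  using coord[of u] by (simp add: l2Z_def)

lemma summable_inner_coord: "(\<lambda>\<gamma>. coord u \<gamma> \<bullet> coord v \<gamma>) summable_on UNIV"
proof -
  have "(\<lambda>\<gamma>. (cmod (coord u \<gamma>))\<^sup>2 + (cmod (coord v \<gamma>))\<^sup>2) summable_on UNIV"
    by (intro summable_on_add summable_coord)
  then have "(\<lambda>\<gamma>. norm (coord u \<gamma> \<bullet> coord v \<gamma>)) summable_on UNIV"
    by (rule Infinite_Sum.abs_summable_on_comparison_test')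
      (simp only: real_norm_def l2Z_cauchy_schwarz_pointwise)
  then show ?thesis by (rule iffD2[OF summable_on_iff_abs_summable_on_real])
qed

instantiation ell2 :: real_inner
begin
definition inner_ell2 :: "ell2 \<Rightarrow> ell2 \<Rightarrow> real" where
  "inner_ell2 u v = (\<Sum>\<^sub>\<infinity>\<gamma>. coord u \<gamma> \<bullet> coord v \<gamma>)"
definition norm_ell2 :: "ell2 \<Rightarrow> real" where "norm_ell2 u = sqrt (u \<bullet> u)"
definition sgn_ell2 :: "ell2 \<Rightarrow> ell2" where "sgn_ell2 u = inverse (norm u) *\<^sub>R u"
definition dist_ell2 :: "ell2 \<Rightarrow> ell2 \<Rightarrow> real" where "dist_ell2 u v = norm (u - v)"
definition uniformity_ell2 :: "(ell2 \<times> ell2) filter" where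
  "uniformity_ell2 = (INF e\<in>{0<..}. principal {(x, y). dist x y < e})"
definition open_ell2 :: "ell2 set \<Rightarrow> bool" where
  "open_ell2 U = (\<forall>x\<in>U. eventually (\<lambda>(x', y). x' = x \<longrightarrow> y \<in> U) uniformity)"
instance
proof
  fix u v w :: ell2 and r :: real
  show "u \<bullet> v = v \<bullet> u" by (simp add: inner_ell2_def inner_commute)
  show "(u + v) \<bullet> w = u \<bullet> w + v \<bullet> w"
    by (simp add: inner_ell2_def inner_add_left infsum_add summable_inner_coord)
  show "(r *\<^sub>R u) \<bullet> v = r * (u \<bullet> v)"
    by (simp add: inner_ell2_def infsum_cmult_right summable_inner_coord)
  show "0 \<le> u \<bullet> u" by (simp add: inner_ell2_def infsum_nonneg)
  show "(u \<bullet> u = 0) = (u = 0)"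
  proof
    assume "u \<bullet> u = 0"
    then have "coord u \<gamma> \<bullet> coord u \<gamma> = 0" for \<gamma>
      unfolding inner_ell2_def
      by (rule nonneg_infsum_le_0D[OF eq_refl]) (auto simp: summable_inner_coord)
    then show "u = 0" by (intro ell2_eqI) simp
  qed (simp add: inner_ell2_def)
qed (fact norm_ell2_def sgn_ell2_def dist_ell2_def uniformity_ell2_def open_ell2_def)+
end

lemma norm_ell2_has_sum: "((\<lambda>\<gamma>. (cmod (coord u \<gamma>))\<^sup>2) has_sum (norm u)\<^sup>2) UNIV"
proof -
  have "(norm u)\<^sup>2 = (\<Sum>\<^sub>\<infinity>\<gamma>. (cmod (coord u \<gamma>))\<^sup>2)"
    unfolding power2_norm_eq_inner inner_ell2_def ..
  then show ?thesis by (simp add: summable_coord)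
qed

lemma norm_ell2_sq: "(norm u)\<^sup>2 = (\<Sum>\<^sub>\<infinity>\<gamma>. (cmod (coord u \<gamma>))\<^sup>2)"
  using norm_ell2_has_sum infsumI by metis

lemma l2Z_norm_coord: "l2Z_norm (coord u) = norm u"
  by (simp add: l2Z_norm_def norm_ell2_sq[symmetric])

lemma finite_sum_coord_le: "finite F \<Longrightarrow> (\<Sum>\<gamma>\<in>F. (cmod (coord u \<gamma>))\<^sup>2) \<le> (norm u)\<^sup>2"
  by (rule finite_sum_le_has_sum[OF norm_ell2_has_sum]) auto

lemma cmod_coord_le: "cmod (coord u \<gamma>) \<le> norm u"
  using finite_sum_coord_le[of "{\<gamma>}" u] by (simp add: power2_le_iff_abs_le)

lemma norm_ell2_sq_leI:
  assumes "\<And>F. finite F \<Longrightarrow> (\<Sum>\<gamma>\<in>F. (cmod (coord u \<gamma>))\<^sup>2) \<le> B"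
  shows "(norm u)\<^sup>2 \<le> B"
  unfolding norm_ell2_sq by (rule infsum_le_finite_sums[OF summable_coord]) (use assms in auto)

lemma norm_ell2_sq_mono:
  assumes "\<And>\<gamma>. (cmod (coord u \<gamma>))\<^sup>2 \<le> C * (cmod (coord v \<gamma>))\<^sup>2"
  shows "(norm u)\<^sup>2 \<le> C * (norm v)\<^sup>2"
  by (rule has_sum_mono[OF norm_ell2_has_sum has_sum_cmult_right[OF norm_ell2_has_sum] assms])

lemma norm_ell2_sq_finite:
  assumes "finite F" "\<And>\<gamma>. \<gamma> \<notin> F \<Longrightarrow> coord u \<gamma> = 0"
  shows "(norm u)\<^sup>2 = (\<Sum>\<gamma>\<in>F. (cmod (coord u \<gamma>))\<^sup>2)"
proof -
  have "(\<Sum>\<^sub>\<infinity>\<gamma>. (cmod (coord u \<gamma>))\<^sup>2) = (\<Sum>\<^sub>\<infinity>\<gamma>\<in>F. (cmod (coord u \<gamma>))\<^sup>2)"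
    by (rule infsum_cong_neutral) (use assms in auto)
  then show ?thesis using assms(1) by (simp add: norm_ell2_sq)
qed

text \<open>Completeness: the coordinatewise limit of a Cauchy sequence bounds every finite partial sum
  of squares by the Cauchy bound, and so is also the limit in norm.\<close>

instance ell2 :: complete_space
proof
  fix X :: "nat \<Rightarrow> ell2"
  assume X: "Cauchy X"
  have "Cauchy (\<lambda>n. coord (X n) \<gamma>)" for \<gamma>
  proof (rule metric_CauchyI)
    fix e :: real assume "e > 0"
    then obtain M where "\<forall>m\<ge>M. \<forall>n\<ge>M. dist (X m) (X n) < e"
      using X by (meson metric_CauchyD)
    then show "\<exists>M. \<forall>m\<ge>M. \<forall>n\<ge>M. dist (coord (X m) \<gamma>) (coord (X n) \<gamma>) < e"
      using cmod_coord_le[of "X m - X n" \<gamma> for m n]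
      unfolding dist_norm by (metis le_less_trans minus_ell2.rep_eq)
  qed
  then have "\<forall>\<gamma>. \<exists>l. (\<lambda>n. coord (X n) \<gamma>) \<longlonglongrightarrow> l"
    by (simp add: Cauchy_convergent_iff convergent_def)
  then obtain l where l: "\<And>\<gamma>. (\<lambda>n. coord (X n) \<gamma>) \<longlonglongrightarrow> l \<gamma>"
    by metis
  have close: "(\<Sum>\<gamma>\<in>F. (cmod (coord (X m) \<gamma> - l \<gamma>))\<^sup>2) \<le> e\<^sup>2"
    if F: "finite F" and M: "\<And>n. n \<ge> M \<Longrightarrow> dist (X m) (X n) < e" for F m e M
  proof (rule tendsto_upperbound)
    show "(\<lambda>n. \<Sum>\<gamma>\<in>F. (cmod (coord (X m) \<gamma> - coord (X n) \<gamma>))\<^sup>2)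
        \<longlonglongrightarrow> (\<Sum>\<gamma>\<in>F. (cmod (coord (X m) \<gamma> - l \<gamma>))\<^sup>2)"
      by (intro tendsto_intros l)
    show "\<forall>\<^sub>F n in sequentially. (\<Sum>\<gamma>\<in>F. (cmod (coord (X m) \<gamma> - coord (X n) \<gamma>))\<^sup>2) \<le> e\<^sup>2"
    proof (rule eventually_sequentiallyI[of M])
      fix n assume "M \<le> n"
      then have "(norm (X m - X n))\<^sup>2 \<le> e\<^sup>2"
        using M[of n] by (intro power_mono) (auto simp: dist_norm)
      then show "(\<Sum>\<gamma>\<in>F. (cmod (coord (X m) \<gamma> - coord (X n) \<gamma>))\<^sup>2) \<le> e\<^sup>2"
        using finite_sum_coord_le[OF F, of "X m - X n"] by simp
    qed
  qed simp
  obtain M1 where M1: "\<forall>m\<ge>M1. \<forall>n\<ge>M1. dist (X m) (X n) < 1"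
    using X by (meson metric_CauchyD zero_less_one)
  have "(\<lambda>\<gamma>. (cmod (coord (X M1) \<gamma> - l \<gamma>))\<^sup>2) summable_on UNIV"
    by (rule nonneg_bdd_above_summable_on) (use close[of _ M1 M1 1] M1 in \<open>auto intro!: bdd_aboveI[of _ 1]\<close>)
  then have "(\<lambda>\<gamma>. coord (X M1) \<gamma> - l \<gamma>) \<in> l2Z" by (simp add: l2Z_def)
  then have "(\<lambda>\<gamma>. coord (X M1) \<gamma> + (l \<gamma> - coord (X M1) \<gamma>)) \<in> l2Z"
    by (intro l2Z_add coord) (simp add: l2Z_def norm_minus_commute)
  then have "l \<in> l2Z" by simp
  then obtain L where L: "coord L = l" using Abs_ell2_inverse by blast
  have "X \<longlonglongrightarrow> L"
  proof (rule metric_LIMSEQ_I)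
    fix e :: real assume e: "e > 0"
    then obtain M where M: "\<forall>m\<ge>M. \<forall>n\<ge>M. dist (X m) (X n) < e/2"
      using X half_gt_zero by (meson metric_CauchyD)
    have "dist (X m) L < e" if "m \<ge> M" for m
    proof -
      have "(norm (X m - L))\<^sup>2 \<le> (e/2)\<^sup>2"
        by (rule norm_ell2_sq_leI) (use close[of _ M m "e/2"] M that L in auto)
      then have "norm (X m - L) \<le> e/2" using e by (simp add: power2_le_iff_abs_le)
      then show ?thesis using e by (simp add: dist_norm)
    qed
    then show "\<exists>M. \<forall>m\<ge>M. dist (X m) L < e" by blast
  qed
  then show "convergent X" by (auto simp: convergent_def)
qed

section \<open>Symmetric bounded operators on a real Hilbert space\<close>

definition bounded_below :: "('a::real_normed_vector \<Rightarrow> 'a) \<Rightarrow> bool" where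
  "bounded_below T \<longleftrightarrow> (\<exists>c>0. \<forall>x. c * norm x \<le> norm (T x))"

text \<open>Orthogonal complements are avoided: \<open>x \<mapsto> x - t (B (B x) - y)\<close> is a contraction for
  small \<open>t\<close>, because
  \<open>|x - t B B x|^2 \<le> |x|^2 - 2 t |B x|^2 + t^2 M^2 |B x|^2\<close>, and its fixed point solves
  \<open>B (B x) = y\<close>.\<close>

lemma symmetric_bounded_below_surj:
  fixes B :: "'a::{real_inner,complete_space} \<Rightarrow> 'a"
  assumes B: "bounded_linear B" and sym: "\<And>x y. B x \<bullet> y = x \<bullet> B y" and "bounded_below B"
  shows "surj B"
proof -
  interpret bounded_linear B by (rule B)
  obtain c where c: "c > 0" "\<And>x. c * norm x \<le> norm (B x)"
    using assms(3) unfolding bounded_below_def by blast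
  obtain K where K: "K > 0" "\<And>x. norm (B x) \<le> norm x * K"
    using pos_bounded by blast
  define M where "M = K + c"
  have M: "M > 0" "c < M" and MB: "norm (B x) \<le> M * norm x" for x
    using K c(1) K(2)[of x] by (auto simp: M_def algebra_simps intro: order_trans add_increasing2)
  define t where "t = 1 / M\<^sup>2"
  define q where "q = sqrt (1 - t * c\<^sup>2)"
  have t: "t > 0" "t * M\<^sup>2 = 1" using M by (auto simp: t_def)
  have "t * c\<^sup>2 < t * M\<^sup>2"
    using t(1) M(2) c(1) by (intro mult_strict_left_mono power_strict_mono) auto
  then have q: "0 \<le> q" "q < 1" and q2: "q\<^sup>2 = 1 - t * c\<^sup>2"
    using t c(1) by (auto simp: q_def)
  have contr: "norm (x - t *\<^sub>R B (B x)) \<le> q * norm x" for x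
  proof -
    have "(norm (x - t *\<^sub>R B (B x)))\<^sup>2 = (norm x)\<^sup>2 - 2 * t * (x \<bullet> B (B x)) + t\<^sup>2 * (norm (B (B x)))\<^sup>2"
      unfolding power2_norm_eq_inner
      by (simp add: inner_diff_left inner_diff_right inner_commute power2_eq_square algebra_simps)
    also have "x \<bullet> B (B x) = (norm (B x))\<^sup>2"
      by (simp add: sym[symmetric] power2_norm_eq_inner)
    also have "t\<^sup>2 * (norm (B (B x)))\<^sup>2 \<le> t\<^sup>2 * (M * norm (B x))\<^sup>2"
      by (intro mult_left_mono power_mono MB) auto
    also have "\<dots> = t * (t * M\<^sup>2) * (norm (B x))\<^sup>2"
      by (simp add: power2_eq_square algebra_simps)
    also have "\<dots> = t * (norm (B x))\<^sup>2" using t(2) by simp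
    finally have "(norm (x - t *\<^sub>R B (B x)))\<^sup>2 \<le> (norm x)\<^sup>2 - t * (norm (B x))\<^sup>2" by simp
    also have "\<dots> \<le> (norm x)\<^sup>2 - t * (c * norm x)\<^sup>2"
      using t(1) c by (intro diff_left_mono mult_left_mono power_mono) auto
    also have "\<dots> = (q * norm x)\<^sup>2" by (simp add: power_mult_distrib q2 algebra_simps)
    finally show ?thesis by (rule power2_le_imp_le) (simp add: q(1))
  qed
  show "surj B"
  proof (rule surjI)
    fix y
    define f where "f x = x - t *\<^sub>R (B (B x) - y)" for x
    have "dist (f x) (f z) \<le> q * dist x z" for x z
    proof -
      have "f x - f z = (x - z) - t *\<^sub>R B (B (x - z))"
        by (simp add: f_def diff algebra_simps)
      then show ?thesis using contr[of "x - z"] by (simp add: dist_norm)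
    qed
    then have "\<exists>!x. f x = x" by (intro banach_fix_type[OF q]) auto
    then obtain x where "f x = x" by auto
    then have "B (B x) = y" using t(1) by (auto simp: f_def)
    then show "B (SOME x. B x = y) = y" by (rule someI)
  qed
qed

text \<open>Cauchy--Schwarz for the form \<open>T x \<bullet> y\<close>, obtained from \<open>0 \<le> T z \<bullet> z\<close> at
  \<open>z = x - T x / K\<close>.\<close>

lemma positive_symmetric_norm_bound:
  fixes T :: "'a::real_inner \<Rightarrow> 'a"
  assumes "linear T" and sym: "\<And>x y. T x \<bullet> y = x \<bullet> T y"
    and pos: "\<And>x. 0 \<le> T x \<bullet> x" and K: "K > 0" "\<And>x. norm (T x) \<le> K * norm x"
  shows "(norm (T x))\<^sup>2 \<le> K * (T x \<bullet> x)"
proof -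
  define t where "t = 1 / K"
  have t: "t > 0" "t * K = 1" using K(1) by (auto simp: t_def)
  interpret linear T by (rule assms(1))
  have "T (T x) \<bullet> T x \<le> norm (T (T x)) * norm (T x)" by (rule norm_cauchy_schwarz)
  also have "\<dots> \<le> K * norm (T x) * norm (T x)" by (intro mult_right_mono K) auto
  finally have 1: "T (T x) \<bullet> T x \<le> K * (norm (T x))\<^sup>2" by (simp add: power2_eq_square)
  have "0 \<le> T (x - t *\<^sub>R T x) \<bullet> (x - t *\<^sub>R T x)" by (rule pos)
  also have "\<dots> = T x \<bullet> x - 2 * t * (norm (T x))\<^sup>2 + t\<^sup>2 * (T (T x) \<bullet> T x)"
    by (simp add: diff scaleR inner_diff_left inner_diff_right power2_norm_eq_inner
        sym[of "T x" x] power2_eq_square[of t] algebra_simps)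
  also have "\<dots> \<le> T x \<bullet> x - 2 * t * (norm (T x))\<^sup>2 + t\<^sup>2 * (K * (norm (T x))\<^sup>2)"
    by (intro add_left_mono mult_left_mono 1) auto
  also have "t\<^sup>2 * (K * (norm (T x))\<^sup>2) = t * (t * K) * (norm (T x))\<^sup>2"
    by (simp add: power2_eq_square)
  also have "\<dots> = t * (norm (T x))\<^sup>2" using t(2) by simp
  finally have "t * (norm (T x))\<^sup>2 \<le> T x \<bullet> x" by simp
  then have "K * (t * (norm (T x))\<^sup>2) \<le> K * (T x \<bullet> x)"
    using K(1) by (intro mult_left_mono) auto
  then show ?thesis using t(2) by (simp add: mult.assoc[symmetric] mult.commute[of K t])
qed

text \<open>For \<open>s = inf |B x| / |x|\<close> the operator \<open>B^2 - s^2\<close> is positive and its form comes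
  arbitrarily close to 0, so by the previous lemma it is not bounded below; hence one of its
  commuting factors \<open>B - s\<close>, \<open>B + s\<close> is not bounded below either. This replaces the identity
  between the norm of the resolvent and the distance to the spectrum.\<close>

lemma spectrum_near_quasimode:
  fixes B :: "'a::real_inner \<Rightarrow> 'a"
  assumes B: "bounded_linear B" and sym: "\<And>x y. B x \<bullet> y = x \<bullet> B y"
    and u: "u \<noteq> 0" "norm (B u) \<le> e * norm u"
  obtains \<mu> where "\<bar>\<mu>\<bar> \<le> e" "\<not> bounded_below (\<lambda>x. B x - \<mu> *\<^sub>R x)"
proof -
  interpret bounded_linear B by (rule B)
  define S where "S = {norm (B x) | x. norm x = 1}"
  define s where "s = Inf S"
  have unit: "norm (B (x /\<^sub>R norm x)) = norm (B x) / norm x" for x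
    by (simp add: scaleR divide_inverse mult.commute)
  have inS: "norm (B x) / norm x \<in> S" if "x \<noteq> 0" for x
    unfolding S_def using that unit[of x, symmetric] by (intro CollectI exI[of _ "x /\<^sub>R norm x"]) auto
  have S: "S \<noteq> {}" "bdd_below S"
    using inS[OF u(1)] by (auto simp: S_def intro: bdd_belowI[of _ 0])
  have s0: "0 \<le> s" unfolding s_def using S by (intro cInf_greatest) (auto simp: S_def)
  have "s \<le> norm (B u) / norm u" unfolding s_def by (intro cInf_lower inS u S)
  also have "\<dots> \<le> e" using u by (simp add: divide_le_eq)
  finally have se: "s \<le> e" .
  have low: "s * norm x \<le> norm (B x)" for x
  proof (cases "x = 0")
    case False
    then have "s \<le> norm (B x) / norm x" unfolding s_def by (intro cInf_lower inS S)
    then show ?thesis using False by (simp add: le_divide_eq)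
  qed (simp add: zero)
  define T where "T x = B (B x) - s\<^sup>2 *\<^sub>R x" for x
  have bl: "bounded_linear T"
    unfolding T_def
    by (intro bounded_linear_sub bounded_linear_compose[OF B B] bounded_linear_scaleR_right)
  then obtain K where K: "K > 0" "\<And>x. norm (T x) \<le> K * norm x"
    by (metis bounded_linear.pos_bounded mult.commute)
  have Tform: "T x \<bullet> x = (norm (B x))\<^sup>2 - s\<^sup>2 * (norm x)\<^sup>2" for x
    by (simp add: T_def inner_diff_left sym[of "B x" x] power2_norm_eq_inner)
  have Tpos: "0 \<le> T x \<bullet> x" for x
    using power_mono[OF low[of x], of 2] s0 by (simp add: Tform power_mult_distrib)
  have Tsym: "T x \<bullet> y = x \<bullet> T y" for x y
    by (simp add: T_def inner_diff_left inner_diff_right sym)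
  note bound = positive_symmetric_norm_bound[OF bounded_linear.linear[OF bl] Tsym Tpos K]
  have "\<not> (bounded_below (\<lambda>x. B x - s *\<^sub>R x) \<and> bounded_below (\<lambda>x. B x - (-s) *\<^sub>R x))"
  proof (safe)
    assume "bounded_below (\<lambda>x. B x - s *\<^sub>R x)" "bounded_below (\<lambda>x. B x - (-s) *\<^sub>R x)"
    then obtain c d where c: "c > 0" "\<And>x. c * norm x \<le> norm (B x - s *\<^sub>R x)"
      and d: "d > 0" "\<And>x. d * norm x \<le> norm (B x + s *\<^sub>R x)"
      unfolding bounded_below_def by auto
    have factor: "c * d * norm x \<le> norm (T x)" for x
    proof -
      have "c * (d * norm x) \<le> c * norm (B x + s *\<^sub>R x)" using c(1) d by (intro mult_left_mono) auto
      also have "\<dots> \<le> norm (B (B x + s *\<^sub>R x) - s *\<^sub>R (B x + s *\<^sub>R x))" by (rule c)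
      also have "B (B x + s *\<^sub>R x) - s *\<^sub>R (B x + s *\<^sub>R x) = T x"
        by (simp add: T_def add scaleR power2_eq_square algebra_simps)
      finally show ?thesis by (simp add: mult.assoc)
    qed
    define r where "r = sqrt (s\<^sup>2 + (c * d)\<^sup>2 / K)"
    have pos: "(c * d)\<^sup>2 / K > 0" using c d K by simp
    have "r \<le> y" if "y \<in> S" for y
    proof -
      from that obtain x where x: "norm x = 1" "y = norm (B x)" by (auto simp: S_def)
      have "(c * d)\<^sup>2 \<le> (norm (T x))\<^sup>2"
        using factor[of x] x c(1) d(1) by (intro power_mono) auto
      also have "\<dots> \<le> K * (T x \<bullet> x)" by (rule bound)
      also have "\<dots> = (y\<^sup>2 - s\<^sup>2) * K" by (simp add: Tform x)
      finally have "(c * d)\<^sup>2 / K \<le> y\<^sup>2 - s\<^sup>2" using K(1) by (simp add: divide_le_eq)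
      then show "r \<le> y" unfolding r_def using x by (intro real_le_lsqrt) auto
    qed
    then have "r \<le> s" unfolding s_def by (intro cInf_greatest S)
    moreover have "s < r" unfolding r_def using pos s0 by (intro real_less_rsqrt) auto
    ultimately show False by simp
  qed
  then show ?thesis using that[of s] that[of "-s"] s0 se by auto
qed

text \<open>This is the approximate point spectrum on the real line, which can be handled by estimates
  alone. For bounded symmetric operators on a Hilbert space it is the whole real spectrum, by
  \<open>symmetric_bounded_below_surj\<close>.\<close>

definition real_spectrum :: "('a::real_normed_vector \<Rightarrow> 'a) \<Rightarrow> real set" where
  "real_spectrum T = {z. \<not> bounded_below (\<lambda>x. T x - z *\<^sub>R x)}"

lemma real_spectrum_quasimode:
  assumes "z \<in> real_spectrum T" "e > 0"
  obtains u where "u \<noteq> 0" "norm (T u - z *\<^sub>R u) \<le> e * norm u"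
proof -
  obtain u where "norm (T u - z *\<^sub>R u) < e * norm u"
    using assms unfolding real_spectrum_def bounded_below_def by (auto simp: not_le)
  moreover from this have "u \<noteq> 0" by (metis norm_ge_zero norm_zero mult_zero_right not_le)
  ultimately show ?thesis using that[of u] by auto
qed

lemma shifted_symmetric:
  fixes T :: "'a::real_inner \<Rightarrow> 'a"
  assumes "bounded_linear T" "\<And>x y. T x \<bullet> y = x \<bullet> T y"
  shows "bounded_linear (\<lambda>x. T x - z *\<^sub>R x)"
    and "(T x - z *\<^sub>R x) \<bullet> y = x \<bullet> (T y - z *\<^sub>R y)"
  using assms by (auto intro: bounded_linear_sub bounded_linear_scaleR_right
      simp: inner_diff_left inner_diff_right)

lemma real_spectrum_near:
  fixes T :: "'a::real_inner \<Rightarrow> 'a"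
  assumes T: "bounded_linear T" "\<And>x y. T x \<bullet> y = x \<bullet> T y"
    and u: "u \<noteq> 0" "norm (T u - z *\<^sub>R u) \<le> e * norm u"
  obtains \<mu> where "\<mu> \<in> real_spectrum T" "\<bar>\<mu> - z\<bar> \<le> e"
proof -
  obtain \<nu> where \<nu>: "\<bar>\<nu>\<bar> \<le> e" "\<not> bounded_below (\<lambda>x. T x - z *\<^sub>R x - \<nu> *\<^sub>R x)"
    using spectrum_near_quasimode[OF shifted_symmetric[OF T] u] by blast
  have "(\<lambda>x. T x - z *\<^sub>R x - \<nu> *\<^sub>R x) = (\<lambda>x. T x - (z + \<nu>) *\<^sub>R x)"
    by (simp add: algebra_simps)
  then show ?thesis using that[of "z + \<nu>"] \<nu> by (simp add: real_spectrum_def)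
qed

lemma real_spectrum_nonempty:
  fixes T :: "'a::real_inner \<Rightarrow> 'a"
  assumes "bounded_linear T" "\<And>x y. T x \<bullet> y = x \<bullet> T y" "(u::'a) \<noteq> 0"
  shows "real_spectrum T \<noteq> {}"
proof -
  have "norm (T u - 0 *\<^sub>R u) \<le> (norm (T u) / norm u) * norm u" using assms(3) by simp
  then show ?thesis using real_spectrum_near[OF assms(1,2,3)] by blast
qed

lemma real_spectrum_bounded:
  fixes T :: "'a::real_normed_vector \<Rightarrow> 'a"
  assumes "\<And>x. norm (T x - a *\<^sub>R x) \<le> K * norm x" "z \<in> real_spectrum T"
  shows "\<bar>z - a\<bar> \<le> K"
proof (rule ccontr)
  assume "\<not> \<bar>z - a\<bar> \<le> K"
  moreover have "(\<bar>z - a\<bar> - K) * norm x \<le> norm (T x - z *\<^sub>R x)" for x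
  proof -
    have "(T x - a *\<^sub>R x) - (T x - z *\<^sub>R x) = (z - a) *\<^sub>R x" by (simp add: algebra_simps)
    then have "\<bar>z - a\<bar> * norm x \<le> norm (T x - a *\<^sub>R x) + norm (T x - z *\<^sub>R x)"
      by (metis norm_scaleR norm_triangle_ineq4)
    then show ?thesis using assms(1)[of x] by (simp add: left_diff_distrib)
  qed
  ultimately have "bounded_below (\<lambda>x. T x - z *\<^sub>R x)"
    unfolding bounded_below_def by (intro exI[of _ "\<bar>z - a\<bar> - K"]) auto
  with assms(2) show False by (simp add: real_spectrum_def)
qed

lemma closed_real_spectrum: "closed (real_spectrum T)"
  unfolding closed_def open_dist
proof
  fix z assume "z \<in> - real_spectrum T"
  then obtain c where c: "c > 0" "\<And>x. c * norm x \<le> norm (T x - z *\<^sub>R x)"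
    by (auto simp: real_spectrum_def bounded_below_def)
  have "\<mu> \<in> - real_spectrum T" if "dist \<mu> z < c/2" for \<mu>
  proof -
    have "(c/2) * norm x \<le> norm (T x - \<mu> *\<^sub>R x)" for x
    proof -
      have "T x - z *\<^sub>R x = (T x - \<mu> *\<^sub>R x) + (\<mu> - z) *\<^sub>R x" by (simp add: algebra_simps)
      then have "norm (T x - z *\<^sub>R x) \<le> norm (T x - \<mu> *\<^sub>R x) + \<bar>\<mu> - z\<bar> * norm x"
        by (metis norm_scaleR norm_triangle_ineq)
      also have "\<bar>\<mu> - z\<bar> * norm x \<le> (c/2) * norm x"
        using that by (intro mult_right_mono) (auto simp: dist_real_def)
      finally show ?thesis using c(2)[of x] by simp
    qed
    then show ?thesis using c(1) unfolding real_spectrum_def bounded_below_def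
      by (auto intro!: exI[of _ "c/2"])
  qed
  then show "\<exists>e>0. \<forall>y. dist y z < e \<longrightarrow> y \<in> - real_spectrum T" using c(1) half_gt_zero by blast
qed

section \<open>Discrete Schroedinger operators\<close>

lemma l2Z_translate: "(\<lambda>\<gamma>. u (\<gamma> + k)) \<in> l2Z" if "u \<in> l2Z"
proof -
  have "bij_betw (\<lambda>\<gamma>::int. \<gamma> + k) UNIV UNIV"
    by (rule bij_betw_byWitness[where f'="\<lambda>\<gamma>. \<gamma> - k"]) auto
  from summable_on_reindex_bij_betw[OF this, of "\<lambda>\<gamma>. (cmod (u \<gamma>))\<^sup>2"] that
  show ?thesis by (simp add: l2Z_def)
qed

lift_definition translate :: "int \<Rightarrow> ell2 \<Rightarrow> ell2" is "\<lambda>k u \<gamma>. u (\<gamma> + k)"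
  by (rule l2Z_translate)

declare translate.rep_eq [simp]

lemma has_sum_int_translate:
  "((\<lambda>\<gamma>::int. f (\<gamma> + k)) has_sum s) UNIV \<longleftrightarrow> (f has_sum s) UNIV"
  by (rule has_sum_reindex_bij_betw)
    (rule bij_betw_byWitness[where f'="\<lambda>\<gamma>. \<gamma> - k"], auto)

lemma translate_inner: "translate k u \<bullet> v = u \<bullet> translate (-k) v"
proof -
  have "((\<lambda>\<gamma>. coord (translate k u) \<gamma> \<bullet> coord v \<gamma>) has_sum translate k u \<bullet> v) UNIV"
    unfolding inner_ell2_def by (intro has_sum_infsum summable_inner_coord)
  then have "((\<lambda>\<gamma>. coord u (\<gamma> + k) \<bullet> coord (translate (-k) v) (\<gamma> + k)) has_sum translate k u \<bullet> v) UNIV"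
    by simp
  then have "((\<lambda>\<gamma>. coord u \<gamma> \<bullet> coord (translate (-k) v) \<gamma>) has_sum translate k u \<bullet> v) UNIV"
    by (rule iffD1[OF has_sum_int_translate])
  then show ?thesis by (simp add: inner_ell2_def infsumI)
qed

lemma norm_translate [simp]: "norm (translate k u) = norm u"
proof -
  have "translate (-k) (translate k u) = u" by (rule ell2_eqI) simp
  then show ?thesis by (simp add: norm_eq_sqrt_inner translate_inner)
qed

lemma bounded_linear_translate: "bounded_linear (translate k)"
  by (rule bounded_linear_intro[where K=1]) (auto intro: ell2_eqI)

definition mult_ell2 :: "(int \<Rightarrow> real) \<Rightarrow> ell2 \<Rightarrow> ell2" where
  "mult_ell2 g u = Abs_ell2 (\<lambda>\<gamma>. g \<gamma> *\<^sub>R coord u \<gamma>)"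

lemma coord_mult_ell2:
  assumes "\<And>\<gamma>. \<bar>g \<gamma>\<bar> \<le> B"
  shows "coord (mult_ell2 g u) \<gamma> = g \<gamma> *\<^sub>R coord u \<gamma>"
  unfolding mult_ell2_def using l2Z_mult[of "coord u" g B] assms coord by (simp add: Abs_ell2_inverse)

lemma norm_mult_ell2:
  assumes g: "\<And>\<gamma>. \<bar>g \<gamma>\<bar> \<le> B"
  shows "norm (mult_ell2 g u) \<le> B * norm u"
proof -
  have B: "0 \<le> B" using g[of 0] by simp
  have "(norm (mult_ell2 g u))\<^sup>2 \<le> B\<^sup>2 * (norm u)\<^sup>2"
  proof (rule norm_ell2_sq_mono)
    fix \<gamma>
    have "(g \<gamma>)\<^sup>2 \<le> B\<^sup>2" using g[of \<gamma>] by (metis abs_ge_zero power2_abs power_mono)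
    then show "(cmod (coord (mult_ell2 g u) \<gamma>))\<^sup>2 \<le> B\<^sup>2 * (cmod (coord u \<gamma>))\<^sup>2"
      by (simp add: coord_mult_ell2[OF g] power_mult_distrib mult_right_mono)
  qed
  then have "(norm (mult_ell2 g u))\<^sup>2 \<le> (B * norm u)\<^sup>2" by (simp add: power_mult_distrib)
  then show ?thesis by (rule power2_le_imp_le) (simp add: B)
qed

lemma bounded_linear_mult_ell2:
  assumes g: "\<And>\<gamma>. \<bar>g \<gamma>\<bar> \<le> B"
  shows "bounded_linear (mult_ell2 g)"
proof (rule bounded_linear_intro)
  show "norm (mult_ell2 g u) \<le> norm u * B" for u
    using norm_mult_ell2[where u=u, OF g] by (simp add: mult.commute)
qed (auto intro!: ell2_eqI simp: coord_mult_ell2[OF g] scaleR_add_right)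

lemma mult_ell2_inner:
  assumes g: "\<And>\<gamma>. \<bar>g \<gamma>\<bar> \<le> B"
  shows "mult_ell2 g u \<bullet> v = u \<bullet> mult_ell2 g v"
  by (simp add: inner_ell2_def coord_mult_ell2[OF g])

definition schroedinger :: "(int \<Rightarrow> real) \<Rightarrow> ell2 \<Rightarrow> ell2" where
  "schroedinger W u = 2 *\<^sub>R u - translate 1 u - translate (-1) u + mult_ell2 W u"

abbreviation (input) sampled :: "(real \<Rightarrow> real) \<Rightarrow> real \<Rightarrow> int \<Rightarrow> real" where
  "sampled V h \<equiv> \<lambda>\<gamma>. V (h * of_int \<gamma>)"

lemma coord_schroedinger:
  assumes "\<And>\<gamma>. \<bar>W \<gamma>\<bar> \<le> B"
  shows "coord (schroedinger W u) \<gamma> =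
    2 *\<^sub>R coord u \<gamma> - coord u (\<gamma> + 1) - coord u (\<gamma> - 1) + W \<gamma> *\<^sub>R coord u \<gamma>"
  by (simp add: schroedinger_def coord_mult_ell2[OF assms])

lemma bounded_linear_schroedinger:
  assumes W: "\<And>\<gamma>. \<bar>W \<gamma>\<bar> \<le> B"
  shows "bounded_linear (schroedinger W)"
  unfolding schroedinger_def
  by (intro bounded_linear_add bounded_linear_sub bounded_linear_translate
      bounded_linear_mult_ell2[OF W] bounded_linear_scaleR_right)

lemma schroedinger_inner:
  assumes W: "\<And>\<gamma>. \<bar>W \<gamma>\<bar> \<le> B"
  shows "schroedinger W u \<bullet> v = u \<bullet> schroedinger W v"
  unfolding schroedinger_def
  by (simp add: inner_add_left inner_add_right inner_diff_left inner_diff_right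
      translate_inner mult_ell2_inner[OF W])

lemma norm_schroedinger:
  assumes W: "\<And>\<gamma>. \<bar>W \<gamma> - a\<bar> \<le> B"
  shows "norm (schroedinger W u - (2 + a) *\<^sub>R u) \<le> (2 + B) * norm u"
proof -
  have W': "\<bar>W \<gamma>\<bar> \<le> \<bar>a\<bar> + B" for \<gamma> using W[of \<gamma>] by linarith
  have "schroedinger W u - (2 + a) *\<^sub>R u =
      mult_ell2 (\<lambda>\<gamma>. W \<gamma> - a) u - (translate 1 u + translate (-1) u)"
    by (rule ell2_eqI)
      (simp add: coord_schroedinger[OF W'] coord_mult_ell2[OF W] scaleR_conv_of_real algebra_simps)
  then have "norm (schroedinger W u - (2 + a) *\<^sub>R u) \<le>
      norm (mult_ell2 (\<lambda>\<gamma>. W \<gamma> - a) u) + norm (translate 1 u + translate (-1) u)"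
    by (simp add: norm_triangle_ineq4)
  also have "norm (translate 1 u + translate (-1) u) \<le> 2 * norm u"
    using norm_triangle_ineq[of "translate 1 u" "translate (-1) u"] by simp
  also have "norm (mult_ell2 (\<lambda>\<gamma>. W \<gamma> - a) u) \<le> B * norm u" by (rule norm_mult_ell2[OF W])
  finally show ?thesis by (simp add: algebra_simps)
qed

lift_definition unit_ell2 :: "int \<Rightarrow> ell2" is "\<lambda>k \<gamma>. if \<gamma> = k then 1 else 0"
proof -
  fix k :: int
  show "(\<lambda>\<gamma>. if \<gamma> = k then 1 else 0) \<in> l2Z"
    unfolding l2Z_def mem_Collect_eq
    by (rule iffD2[OF summable_on_cong_neutral[where T="{k}" and g="\<lambda>_. 1"]]) auto
qed

lemma unit_ell2_nonzero: "unit_ell2 k \<noteq> 0"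
proof
  assume "unit_ell2 k = 0"
  then have "coord (unit_ell2 k) k = coord 0 k" by simp
  then show False by (simp add: unit_ell2.rep_eq)
qed

text \<open>The surjectivity lemma enters here: without it a point outside \<open>real_spectrum\<close> could
  still be a point of residual spectrum.\<close>

lemma Spec_P_d_eq_real_spectrum:
  assumes V: "\<And>x. \<bar>V x\<bar> \<le> B"
  shows "Spec_P_d V h = real_spectrum (schroedinger (sampled V h))"
proof -
  have coordP: "coord (schroedinger (sampled V h) u - x *\<^sub>R u) =
      (\<lambda>\<gamma>. P_d V h (coord u) \<gamma> - of_real x * coord u \<gamma>)" for x u
    by (rule ext) (simp add: coord_schroedinger[OF V] P_d_def scaleR_conv_of_real)
  have "complex_of_real x \<in> l2Z_resolvent_set (P_d V h) \<longleftrightarrow>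
      bounded_below (\<lambda>u. schroedinger (sampled V h) u - x *\<^sub>R u)" (is "?L \<longleftrightarrow> bounded_below ?T") for x
  proof
    assume ?L
    then obtain C where C: "\<And>v. v \<in> l2Z \<Longrightarrow>
        l2Z_norm v \<le> C * l2Z_norm (\<lambda>\<gamma>. P_d V h v \<gamma> - of_real x * v \<gamma>)"
      by (auto simp: l2Z_resolvent_set_def)
    have "norm u \<le> (\<bar>C\<bar> + 1) * norm (?T u)" for u
    proof -
      have "norm u \<le> C * norm (?T u)"
        using C[OF coord, of u] by (simp only: coordP[symmetric] l2Z_norm_coord)
      also have "\<dots> \<le> (\<bar>C\<bar> + 1) * norm (?T u)" by (intro mult_right_mono) auto
      finally show ?thesis .
    qed
    then have "1 / (\<bar>C\<bar> + 1) * norm u \<le> norm (?T u)" for u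
      by (simp add: pos_divide_le_eq mult.commute add_nonneg_pos)
    then show "bounded_below ?T"
      unfolding bounded_below_def by (intro exI[of _ "1 / (\<bar>C\<bar> + 1)"]) auto
  next
    assume bb: "bounded_below ?T"
    note T = shifted_symmetric[OF bounded_linear_schroedinger[OF V] schroedinger_inner[OF V]]
    obtain c where c: "c > 0" "\<And>u. c * norm u \<le> norm (?T u)"
      using bb unfolding bounded_below_def by blast
    have surj: "surj ?T" by (rule symmetric_bounded_below_surj[OF T bb])
    have inj: "inj ?T"
    proof (rule injI)
      fix u v assume "?T u = ?T v"
      then have "?T (u - v) = 0" using linear_diff[OF bounded_linear.linear[OF T(1)]] by simp
      then have "c * norm (u - v) \<le> 0" using c(2)[of "u - v"] by simp
      then show "u = v" using c(1) by (simp add: mult_le_0_iff)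
    qed
    have rng: "l2Z = range coord" using type_definition.Rep_range[OF type_definition_ell2] by simp
    have "bij_betw (\<lambda>v \<gamma>. P_d V h v \<gamma> - of_real x * v \<gamma>) l2Z l2Z"
      unfolding bij_betw_def
    proof
      show "inj_on (\<lambda>v \<gamma>. P_d V h v \<gamma> - of_real x * v \<gamma>) l2Z"
        unfolding rng by (rule inj_onI, clarify, simp only: coordP[symmetric] coord_inject)
          (use inj in \<open>auto dest: injD\<close>)
      have "(\<lambda>v \<gamma>. P_d V h v \<gamma> - of_real x * v \<gamma>) ` l2Z = coord ` range ?T"
        unfolding rng image_image by (simp only: coordP)
      then show "(\<lambda>v \<gamma>. P_d V h v \<gamma> - of_real x * v \<gamma>) ` l2Z = l2Z"
        using surj rng by simp
    qed
    moreover have "l2Z_norm v \<le> (1/c) * l2Z_norm (\<lambda>\<gamma>. P_d V h v \<gamma> - of_real x * v \<gamma>)" if "v \<in> l2Z" for v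
    proof -
      from that rng obtain u where u: "v = coord u" by auto
      show ?thesis unfolding u coordP[symmetric] l2Z_norm_coord
        using c by (simp add: le_divide_eq mult.commute)
    qed
    ultimately show ?L unfolding l2Z_resolvent_set_def by blast
  qed
  then show ?thesis
    by (auto simp: Spec_P_d_def l2Z_spectrum_def real_spectrum_def)
qed

section \<open>Localised approximate eigenfunctions\<close>

lemma has_sum_finite_sum:
  fixes g :: "'i \<Rightarrow> 'a \<Rightarrow> real"
  assumes "finite J" "\<And>j. j \<in> J \<Longrightarrow> (g j has_sum s j) A"
  shows "((\<lambda>m. \<Sum>j\<in>J. g j m) has_sum (\<Sum>j\<in>J. s j)) A"
  using assms by (induction J rule: finite_induct) (auto intro!: has_sum_add)

text \<open>The functions \<open>\<psi> (\<gamma> - m) u(\<gamma>)\<close>, with \<open>\<psi>\<close> a tent of height and half-width \<open>N\<close>, have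
  squared norms adding up over \<open>m\<close> to \<open>S |u|^2\<close> with \<open>S \<ge> N^2\<close>, while the commutator of the
  operator with \<open>\<psi>\<close> involves only the slopes of \<open>\<psi>\<close>, at most 1, and contributes \<open>O(N) |u|^2\<close>
  in total. If the quotient were large for every \<open>m\<close>, summing over \<open>m\<close> would give a
  contradiction. The size of the window thus depends on \<open>e\<close> alone, and not on \<open>W\<close>.\<close>

lemma localised_quasimode:
  assumes W: "\<And>\<gamma>. \<bar>W \<gamma>\<bar> \<le> B"
    and u: "u \<noteq> 0" "norm (schroedinger W u - z *\<^sub>R u) \<le> e * norm u"
    and e: "e > 0" "real N * e\<^sup>2 > 24"
  obtains v m where "v \<noteq> 0" "\<And>\<gamma>. \<bar>\<gamma> - m\<bar> > int N \<Longrightarrow> coord v \<gamma> = 0"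
    "norm (schroedinger W v - z *\<^sub>R v) \<le> 2 * e * norm v"
proof -
  define \<psi> :: "int \<Rightarrow> real" where "\<psi> j = of_int (max 0 (int N - \<bar>j\<bar>))" for j
  define f where "f = schroedinger W u - z *\<^sub>R u"
  define J where "J = {- int N..int N}"
  define S where "S = (\<Sum>j\<in>J. (\<psi> j)\<^sup>2)"
  define v where "v m = mult_ell2 (\<lambda>\<gamma>. \<psi> (\<gamma> - m)) u" for m
  define L where "L m = (\<Sum>j\<in>J. (\<psi> j)\<^sup>2 * (cmod (coord u (m + j)))\<^sup>2)" for m
  define R where "R m = (\<Sum>j\<in>J. 2 * (\<psi> j)\<^sup>2 * (cmod (coord f (m + j)))\<^sup>2
    + 4 * (cmod (coord u (m + (j + 1))))\<^sup>2 + 4 * (cmod (coord u (m + (j - 1))))\<^sup>2)" for m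
  have N: "N > 0" using e by (cases N) auto
  have \<psi>b: "\<bar>\<psi> j\<bar> \<le> real N" for j by (auto simp: \<psi>_def)
  have \<psi>0: "\<psi> j = 0" if "\<bar>j\<bar> \<ge> int N" for j using that by (simp add: \<psi>_def)
  have slope: "\<bar>\<psi> (j + 1) - \<psi> j\<bar> \<le> 1" "\<bar>\<psi> (j - 1) - \<psi> j\<bar> \<le> 1" for j
    unfolding \<psi>_def of_int_diff[symmetric] of_int_abs[symmetric] of_int_le_1_iff by linarith+
  have coordv: "coord (v m) \<gamma> = \<psi> (\<gamma> - m) *\<^sub>R coord u \<gamma>" for m \<gamma>
    unfolding v_def by (rule coord_mult_ell2[OF \<psi>b])
  have supp: "coord (v m) \<gamma> = 0" if "\<bar>\<gamma> - m\<bar> > int N" for m \<gamma>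
    using that by (simp add: coordv \<psi>0)
  have fin: "finite J" by (simp add: J_def)
  have window: "(norm w)\<^sup>2 = (\<Sum>j\<in>J. (cmod (coord w (m + j)))\<^sup>2)"
    if "\<And>\<gamma>. \<bar>\<gamma> - m\<bar> > int N \<Longrightarrow> coord w \<gamma> = 0" for w m
  proof -
    have "(norm w)\<^sup>2 = (\<Sum>\<gamma>\<in>(+) m ` J. (cmod (coord w \<gamma>))\<^sup>2)"
    proof (rule norm_ell2_sq_finite)
      fix \<gamma> assume "\<gamma> \<notin> (+) m ` J"
      then have "\<gamma> - m \<notin> J" by (metis add.commute diff_add_cancel imageI)
      then show "coord w \<gamma> = 0" by (intro that) (auto simp: J_def)
    qed (simp add: fin)
    then show ?thesis by (simp add: sum.reindex)
  qed
  have normv: "(norm (v m))\<^sup>2 = L m" for m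
    by (subst window[of m "v m"]) (simp_all add: supp, simp add: L_def coordv power_mult_distrib)
  have coordT: "coord (schroedinger W w - z *\<^sub>R w) \<gamma> =
      (2 + W \<gamma> - z) *\<^sub>R coord w \<gamma> - coord w (\<gamma> + 1) - coord w (\<gamma> - 1)" for w \<gamma>
    by (simp add: coord_schroedinger[OF W] algebra_simps)
  have commutator: "coord (schroedinger W (v m) - z *\<^sub>R v m) (m + j) =
      \<psi> j *\<^sub>R coord f (m + j)
      + (- ((\<psi> (j + 1) - \<psi> j) *\<^sub>R coord u (m + (j + 1)))
      + - ((\<psi> (j - 1) - \<psi> j) *\<^sub>R coord u (m + (j - 1))))" for m j
    unfolding f_def coordT coordv by (simp add: algebra_simps)
  have normT: "(norm (schroedinger W (v m) - z *\<^sub>R v m))\<^sup>2 \<le> R m" for m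
  proof -
    have "coord (schroedinger W (v m) - z *\<^sub>R v m) \<gamma> = 0" if "\<bar>\<gamma> - m\<bar> > int N" for \<gamma>
    proof -
      have "\<psi> (\<gamma> - m) = 0" "\<psi> (\<gamma> + 1 - m) = 0" "\<psi> (\<gamma> - 1 - m) = 0"
        using that by (auto intro!: \<psi>0)
      then show ?thesis by (simp only: coordT coordv) simp
    qed
    then have "(norm (schroedinger W (v m) - z *\<^sub>R v m))\<^sup>2 =
        (\<Sum>j\<in>J. (cmod (coord (schroedinger W (v m) - z *\<^sub>R v m) (m + j)))\<^sup>2)"
      by (rule window)
    also have "\<dots> \<le> R m"
      unfolding R_def
    proof (rule sum_mono)
      fix j
      have small: "(cmod (- (a *\<^sub>R x)))\<^sup>2 \<le> (cmod x)\<^sup>2" if "\<bar>a\<bar> \<le> 1" for a x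
      proof -
        have "cmod (- (a *\<^sub>R x)) \<le> cmod x" using that by (simp add: mult_left_le_one_le)
        then show ?thesis by (rule power_mono) simp
      qed
      let ?p = "(\<psi> (j + 1) - \<psi> j) *\<^sub>R coord u (m + (j + 1))"
      let ?q = "(\<psi> (j - 1) - \<psi> j) *\<^sub>R coord u (m + (j - 1))"
      have "(cmod (coord (schroedinger W (v m) - z *\<^sub>R v m) (m + j)))\<^sup>2
          \<le> 2 * (cmod (\<psi> j *\<^sub>R coord f (m + j)))\<^sup>2 + 2 * (cmod (- ?p + - ?q))\<^sup>2"
        unfolding commutator by (rule cmod_add_sq_le)
      moreover have "(cmod (- ?p + - ?q))\<^sup>2 \<le> 2 * (cmod (- ?p))\<^sup>2 + 2 * (cmod (- ?q))\<^sup>2"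
        by (rule cmod_add_sq_le)
      moreover note small[OF slope(1)[of j], of "coord u (m + (j + 1))"]
        small[OF slope(2)[of j], of "coord u (m + (j - 1))"]
      moreover have "(cmod (\<psi> j *\<^sub>R coord f (m + j)))\<^sup>2 = (\<psi> j)\<^sup>2 * (cmod (coord f (m + j)))\<^sup>2"
        by (simp add: power_mult_distrib)
      ultimately show "(cmod (coord (schroedinger W (v m) - z *\<^sub>R v m) (m + j)))\<^sup>2
          \<le> 2 * (\<psi> j)\<^sup>2 * (cmod (coord f (m + j)))\<^sup>2
    + 4 * (cmod (coord u (m + (j + 1))))\<^sup>2 + 4 * (cmod (coord u (m + (j - 1))))\<^sup>2"
        by linarith
    qed
    finally show ?thesis .
  qed
  have shift: "((\<lambda>m. (cmod (coord w (m + k)))\<^sup>2) has_sum (norm w)\<^sup>2) UNIV" for w k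
    by (rule iffD2[OF has_sum_int_translate norm_ell2_has_sum])
  have Lsum: "(L has_sum S * (norm u)\<^sup>2) UNIV"
    unfolding L_def S_def sum_distrib_right
    by (intro has_sum_finite_sum fin has_sum_cmult_right shift)
  have "(R has_sum (\<Sum>j\<in>J. 2 * (\<psi> j)\<^sup>2 * (norm f)\<^sup>2 + 4 * (norm u)\<^sup>2 + 4 * (norm u)\<^sup>2)) UNIV"
    unfolding R_def by (intro has_sum_finite_sum fin has_sum_add has_sum_cmult_right shift)
  moreover have "(\<Sum>j\<in>J. 2 * (\<psi> j)\<^sup>2 * (norm f)\<^sup>2 + 4 * (norm u)\<^sup>2 + 4 * (norm u)\<^sup>2)
      = 2 * S * (norm f)\<^sup>2 + 8 * (2 * real N + 1) * (norm u)\<^sup>2"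
    by (simp add: sum.distrib S_def sum_distrib_left sum_distrib_right J_def algebra_simps)
  ultimately have Rsum: "(R has_sum (2 * S * (norm f)\<^sup>2 + 8 * (2 * real N + 1) * (norm u)\<^sup>2)) UNIV"
    by simp
  have "\<exists>m. R m < 3 * e\<^sup>2 * L m"
  proof (rule ccontr)
    assume "\<nexists>m. R m < 3 * e\<^sup>2 * L m"
    then have "3 * e\<^sup>2 * (S * (norm u)\<^sup>2) \<le> 2 * S * (norm f)\<^sup>2 + 8 * (2 * real N + 1) * (norm u)\<^sup>2"
      by (intro has_sum_mono[OF has_sum_cmult_right[OF Lsum] Rsum]) (auto simp: not_less)
    also have "2 * S * (norm f)\<^sup>2 \<le> 2 * S * (e * norm u)\<^sup>2"
      using u(2) by (intro mult_left_mono power_mono) (auto simp: S_def f_def sum_nonneg)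
    finally have "(S * e\<^sup>2) * (norm u)\<^sup>2 \<le> (8 * (2 * real N + 1)) * (norm u)\<^sup>2"
      by (simp add: power_mult_distrib algebra_simps)
    then have "S * e\<^sup>2 \<le> 8 * (2 * real N + 1)" using u(1) by simp
    \<comment> \<open>The threshold 24 is chosen for \<open>8 (2 N + 1) \<le> 24 N\<close>.\<close>
    have "real N * 24 < real N * (real N * e\<^sup>2)"
      using N e by (intro mult_strict_left_mono) auto
    also have "\<dots> = (real N)\<^sup>2 * e\<^sup>2" by (simp add: power2_eq_square)
    also have "(real N)\<^sup>2 \<le> S"
      unfolding S_def using member_le_sum[of 0 J "\<lambda>j. (\<psi> j)\<^sup>2"] fin by (simp add: J_def \<psi>_def)
    then have "(real N)\<^sup>2 * e\<^sup>2 \<le> S * e\<^sup>2" by (intro mult_right_mono) auto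
    also have "\<dots> \<le> 8 * (2 * real N + 1)" by fact
    finally show False using N by simp
  qed
  then obtain m where m: "R m < 3 * e\<^sup>2 * L m" by blast
  have "0 \<le> R m" using normT[of m] by (rule order_trans[rotated]) simp
  then have "v m \<noteq> 0" using m normv[of m] by auto
  moreover have "(norm (schroedinger W (v m) - z *\<^sub>R v m))\<^sup>2 \<le> (2 * e * norm (v m))\<^sup>2"
  proof -
    have "(norm (schroedinger W (v m) - z *\<^sub>R v m))\<^sup>2 \<le> 3 * (e\<^sup>2 * L m)" using normT[of m] m by simp
    also have "\<dots> \<le> 4 * (e\<^sup>2 * L m)" by (intro mult_right_mono) (auto simp: normv[symmetric])
    finally show ?thesis by (simp add: power_mult_distrib normv)
  qed
  then have "norm (schroedinger W (v m) - z *\<^sub>R v m) \<le> 2 * e * norm (v m)"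
    by (rule power2_le_imp_le) (use e in auto)
  ultimately show ?thesis using supp by (intro that[of "v m" m])
qed

text \<open>If every window of \<open>W\<close> of radius \<open>N\<close> reappears approximately somewhere in \<open>W'\<close>, localised
  approximate eigenfunctions can be translated to where it reappears.\<close>

lemma spectrum_transfer:
  assumes W: "\<And>\<gamma>. \<bar>W \<gamma>\<bar> \<le> B" and W': "\<And>\<gamma>. \<bar>W' \<gamma>\<bar> \<le> B'"
    and z: "z \<in> real_spectrum (schroedinger W)"
    and e: "e > 0" "real N * e\<^sup>2 > 24"
    and windows: "\<And>m. \<exists>m'. \<forall>j. \<bar>j\<bar> \<le> int N \<longrightarrow> \<bar>W' (m' + j) - W (m + j)\<bar> \<le> e"
  obtains \<mu> where "\<mu> \<in> real_spectrum (schroedinger W')" "\<bar>\<mu> - z\<bar> \<le> 3 * e"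
proof -
  obtain u where u: "u \<noteq> 0" "norm (schroedinger W u - z *\<^sub>R u) \<le> e * norm u"
    by (rule real_spectrum_quasimode[OF z e(1)])
  obtain v m where v: "v \<noteq> 0" "\<And>\<gamma>. \<bar>\<gamma> - m\<bar> > int N \<Longrightarrow> coord v \<gamma> = 0"
    "norm (schroedinger W v - z *\<^sub>R v) \<le> 2 * e * norm v"
    using localised_quasimode[OF W u e] by metis
  obtain m' where m': "\<And>j. \<bar>j\<bar> \<le> int N \<Longrightarrow> \<bar>W' (m' + j) - W (m + j)\<bar> \<le> e"
    using windows[of m] by blast
  define k where "k = m - m'"
  define g where "g \<gamma> = (if \<bar>\<gamma> - m'\<bar> \<le> int N then W' \<gamma> - W (\<gamma> + k) else 0)" for \<gamma>
  have g: "\<bar>g \<gamma>\<bar> \<le> e" for \<gamma>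
    using m'[of "\<gamma> - m'"] e(1) by (auto simp: g_def k_def algebra_simps)
  define w where "w = translate k v"
  have "schroedinger W' w - z *\<^sub>R w = translate k (schroedinger W v - z *\<^sub>R v) + mult_ell2 g w"
  proof (rule ell2_eqI)
    fix \<gamma>
    have "g \<gamma> *\<^sub>R coord v (\<gamma> + k) = (W' \<gamma> - W (\<gamma> + k)) *\<^sub>R coord v (\<gamma> + k)"
      using v(2)[of "\<gamma> + k"] by (auto simp: g_def k_def algebra_simps)
    then show "coord (schroedinger W' w - z *\<^sub>R w) \<gamma> =
        coord (translate k (schroedinger W v - z *\<^sub>R v) + mult_ell2 g w) \<gamma>"
      by (simp add: w_def coord_schroedinger[OF W] coord_schroedinger[OF W']
          coord_mult_ell2[OF g] algebra_simps)
  qed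
  then have "norm (schroedinger W' w - z *\<^sub>R w) \<le>
      norm (schroedinger W v - z *\<^sub>R v) + norm (mult_ell2 g w)"
    using norm_triangle_ineq by (metis norm_translate)
  also have "\<dots> \<le> 2 * e * norm w + e * norm w"
    using v(3) norm_mult_ell2[where u=w, OF g] by (intro add_mono) (auto simp: w_def)
  finally have close: "norm (schroedinger W' w - z *\<^sub>R w) \<le> (3 * e) * norm w" by simp
  have "w \<noteq> 0" using v(1) by (metis norm_eq_zero norm_translate w_def)
  then obtain \<mu> where "\<mu> \<in> real_spectrum (schroedinger W')" "\<bar>\<mu> - z\<bar> \<le> 3 * e"
    using close
    by (rule real_spectrum_near[OF bounded_linear_schroedinger[OF W'] schroedinger_inner[OF W']])
  then show ?thesis by (rule that)
qed

section \<open>Continuity along the irrationals\<close>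

lemma periodic_of_int:
  fixes V :: "real \<Rightarrow> real"
  assumes "\<And>x. V (x + 1) = V x"
  shows "V (x + of_int n) = V x"
proof (induction n rule: int_induct[of _ 0])
  case (step1 i)
  then show ?case using assms[of "x + of_int i"] by (simp add: algebra_simps)
next
  case (step2 i)
  then show ?case using assms[of "x + of_int (i - 1)"] by (simp add: algebra_simps)
qed simp

lemma periodic_continuous_bounded:
  fixes V :: "real \<Rightarrow> real"
  assumes cont: "continuous_on UNIV V" and per: "\<And>x. V (x + 1) = V x"
  obtains B where "\<And>x. \<bar>V x\<bar> \<le> B"
proof -
  have "compact (V ` {0..1})"
    by (rule compact_continuous_image[OF continuous_on_subset[OF cont]]) auto
  then obtain B where B: "\<And>y. y \<in> V ` {0..1} \<Longrightarrow> \<bar>y\<bar> \<le> B"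
    using compact_imp_bounded bounded_iff by (metis real_norm_def)
  have "\<bar>V x\<bar> \<le> B" for x
  proof -
    have "V (frac x) = V (frac x + of_int \<lfloor>x\<rfloor>)" by (rule periodic_of_int[where V=V, OF per, symmetric])
    also have "frac x + of_int \<lfloor>x\<rfloor> = x" by (simp add: frac_def)
    finally have "V x \<in> V ` {0..1}"
      using frac_lt_1[of x] by (intro image_eqI[of _ _ "frac x"]) auto
    then show ?thesis by (rule B)
  qed
  then show ?thesis by (rule that)
qed

lemma periodic_uniformly_continuous:
  fixes V :: "real \<Rightarrow> real"
  assumes cont: "continuous_on UNIV V" and per: "\<And>x. V (x + 1) = V x" and e: "e > 0"
  obtains d where "d > 0" "\<And>x y. \<bar>x - y\<bar> < d \<Longrightarrow> \<bar>V x - V y\<bar> < e"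
proof -
  have "uniformly_continuous_on {-1..2} V"
    by (rule compact_uniformly_continuous[OF continuous_on_subset[OF cont]]) auto
  then obtain d where d: "d > 0"
    "\<And>x y. x \<in> {-1..2} \<Longrightarrow> y \<in> {-1..2} \<Longrightarrow> dist y x < d \<Longrightarrow> dist (V y) (V x) < e"
    using e unfolding uniformly_continuous_on_def by metis
  have "\<bar>V x - V y\<bar> < e" if "\<bar>x - y\<bar> < min d 1" for x y
  proof -
    have "V (x + of_int (- \<lfloor>x\<rfloor>)) = V x" "V (y + of_int (- \<lfloor>x\<rfloor>)) = V y"
      by (rule periodic_of_int[where V=V, OF per])+
    moreover have "dist (V (x + of_int (- \<lfloor>x\<rfloor>))) (V (y + of_int (- \<lfloor>x\<rfloor>))) < e"
      using that by (intro d(2)) (auto simp: dist_real_def, linarith+)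
    ultimately show ?thesis by (simp add: dist_real_def)
  qed
  then show ?thesis using d(1) that[of "min d 1"] by auto
qed

text \<open>For irrational \<open>h'\<close> the orbit \<open>h' m'\<close> is dense modulo 1, so it comes close to every phase
  \<open>h m\<close>; over a window of radius \<open>N\<close> the phases then drift apart by at most \<open>N |h - h'|\<close>.
  For rational \<open>h'\<close> only finitely many phases occur, and this step fails.\<close>

lemma spectra_close:
  assumes cont: "continuous_on UNIV V" and per: "\<And>x. V (x + 1) = V x" and e: "e > 0"
  obtains d where "d > 0"
    "\<And>h h' z. h' \<notin> \<rat> \<Longrightarrow> \<bar>h - h'\<bar> < d \<Longrightarrow> z \<in> Spec_P_d V h \<Longrightarrow> \<exists>\<mu>\<in>Spec_P_d V h'. \<bar>\<mu> - z\<bar> \<le> e"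
proof -
  obtain B where B: "\<And>x. \<bar>V x\<bar> \<le> B" using periodic_continuous_bounded[OF cont per] by blast
  have e3: "e/3 > 0" using e by simp
  obtain d0 where d0: "d0 > 0" "\<And>x y. \<bar>x - y\<bar> < d0 \<Longrightarrow> \<bar>V x - V y\<bar> < e/3"
    using periodic_uniformly_continuous[OF cont per e3] by blast
  obtain N :: nat where N: "real N * (e/3)\<^sup>2 > 24"
    using reals_Archimedean3[of "(e/3)\<^sup>2"] e by auto
  have N0: "real N > 0" using N by (cases N) auto
  define d where "d = d0 / (2 * real N)"
  have "\<exists>\<mu>\<in>Spec_P_d V h'. \<bar>\<mu> - z\<bar> \<le> e"
    if h': "h' \<notin> \<rat>" and close: "\<bar>h - h'\<bar> < d" and z: "z \<in> Spec_P_d V h" for h h' z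
  proof -
    have windows: "\<exists>m'. \<forall>j. \<bar>j\<bar> \<le> int N \<longrightarrow> \<bar>sampled V h' (m' + j) - sampled V h (m + j)\<bar> \<le> e/3" for m
    proof -
      have "d0/2 > 0" using d0 by simp
      then obtain p k where k: "\<bar>of_int k * h' - of_int p - h * of_int m\<bar> < d0/2"
        using sequence_of_fractional_parts_is_dense[OF h'] by metis
      have "\<bar>sampled V h' (k + j) - sampled V h (m + j)\<bar> \<le> e/3" if j: "\<bar>j\<bar> \<le> int N" for j
      proof -
        have "\<bar>real_of_int j * (h' - h)\<bar> \<le> real N * \<bar>h - h'\<bar>"
          unfolding abs_mult abs_minus_commute[of h' h]
          using j by (intro mult_right_mono) (auto simp: of_int_abs[symmetric] simp del: of_int_abs)
        also have "\<dots> < real N * d" using close N0 by (intro mult_strict_left_mono)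
        also have "\<dots> = d0/2" using N0 by (simp add: d_def)
        finally have drift: "\<bar>real_of_int j * (h' - h)\<bar> < d0/2" .
        have "h' * of_int (k + j) + of_int (-p) - h * of_int (m + j)
            = (of_int k * h' - of_int p - h * of_int m) + real_of_int j * (h' - h)"
          by (simp add: algebra_simps)
        then have "\<bar>h' * of_int (k + j) + of_int (-p) - h * of_int (m + j)\<bar> < d0"
          using k drift by linarith
        from d0(2)[OF this] show ?thesis by (simp only: periodic_of_int[where V=V, OF per])
      qed
      then show ?thesis by blast
    qed
    obtain \<mu> where "\<mu> \<in> real_spectrum (schroedinger (sampled V h'))" "\<bar>\<mu> - z\<bar> \<le> 3 * (e/3)"
      using spectrum_transfer[OF B B _ e3 N windows] z
      unfolding Spec_P_d_eq_real_spectrum[OF B] by metis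
    then show ?thesis unfolding Spec_P_d_eq_real_spectrum[OF B] by auto
  qed
  moreover have "d > 0" using d0 N0 by (simp add: d_def)
  ultimately show ?thesis using that[of d] by blast
qed

lemma Spec_P_d_nonempty: "Spec_P_d V h \<noteq> {}" if "\<And>x. \<bar>V x\<bar> \<le> B"
  unfolding Spec_P_d_eq_real_spectrum[OF that]
  by (rule real_spectrum_nonempty[OF bounded_linear_schroedinger[OF that]
        schroedinger_inner[OF that] unit_ell2_nonzero])

lemma Spec_P_d_bounded:
  assumes V: "\<And>x. \<bar>V x\<bar> \<le> B" and "z \<in> Spec_P_d V h"
  shows "\<bar>z - 2\<bar> \<le> 2 + B"
proof (rule real_spectrum_bounded)
  show "norm (schroedinger (sampled V h) u - 2 *\<^sub>R u) \<le> (2 + B) * norm u" for u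
    using norm_schroedinger[where a=0 and B=B and W="sampled V h"] V by simp
  show "z \<in> real_spectrum (schroedinger (sampled V h))"
    using assms(2) unfolding Spec_P_d_eq_real_spectrum[OF V] .
qed

lemma min_Spec_P_d:
  assumes V: "\<And>x. \<bar>V x\<bar> \<le> B"
  shows "min_Spec_P_d V h \<in> Spec_P_d V h" and "z \<in> Spec_P_d V h \<Longrightarrow> min_Spec_P_d V h \<le> z"
proof -
  have bdd: "bdd_below (Spec_P_d V h)"
  proof (rule bdd_belowI)
    show "- B \<le> y" if "y \<in> Spec_P_d V h" for y
      using Spec_P_d_bounded[where V=V, OF V that] by linarith
  qed
  have "closed (Spec_P_d V h)"
    unfolding Spec_P_d_eq_real_spectrum[OF V] by (rule closed_real_spectrum)
  then have "Inf (Spec_P_d V h) \<in> Spec_P_d V h"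
    by (intro closed_contains_Inf Spec_P_d_nonempty[where V=V, OF V] bdd)
  moreover from this have "min_Spec_P_d V h = Inf (Spec_P_d V h)"
    unfolding min_Spec_P_d_def by (rule Least_equality) (rule cInf_lower[OF _ bdd])
  ultimately show "min_Spec_P_d V h \<in> Spec_P_d V h"
    "z \<in> Spec_P_d V h \<Longrightarrow> min_Spec_P_d V h \<le> z"
    by (auto intro: cInf_lower[OF _ bdd])
qed

lemma hausdorff_dist_le:
  fixes A B :: "real set"
  assumes "A \<noteq> {}" "B \<noteq> {}"
    and AB: "\<And>a. a \<in> A \<Longrightarrow> \<exists>b\<in>B. \<bar>b - a\<bar> \<le> e" and BA: "\<And>b. b \<in> B \<Longrightarrow> \<exists>a\<in>A. \<bar>a - b\<bar> \<le> e"
  shows "hausdorff_dist A B \<le> e" and "0 \<le> hausdorff_dist A B"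
proof -
  have inf: "infdist x Y \<le> e" if "\<exists>y\<in>Y. \<bar>y - x\<bar> \<le> e" for x :: real and Y
    using that by (metis abs_minus_commute dist_real_def infdist_le2)
  have "(SUP a\<in>A. infdist a B) \<le> e" "(SUP b\<in>B. infdist b A) \<le> e"
    using assms inf by (auto intro!: cSUP_least)
  then show "hausdorff_dist A B \<le> e" by (simp add: hausdorff_dist_def)
  obtain a where a: "a \<in> A" using assms(1) by blast
  have "bdd_above ((\<lambda>a. infdist a B) ` A)" using inf AB by (intro bdd_aboveI[of _ e]) auto
  then have "infdist a B \<le> (SUP a\<in>A. infdist a B)" by (intro cSUP_upper a)
  then show "0 \<le> hausdorff_dist A B"
    unfolding hausdorff_dist_def using infdist_nonneg[of a B] by linarith
qed

lemma continuity_on_irrationals: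
  assumes "C1_periodic V"
  shows "continuous_on (- \<rat>) (min_Spec_P_d V)" and "hausdorff_continuous_on (- \<rat>) (Spec_P_d V)"
proof -
  have per: "\<And>x. V (x + 1) = V x" and cont: "continuous_on UNIV V"
    using assms C1_differentiable_imp_continuous_on by (auto simp: C1_periodic_def)
  obtain B where B: "\<And>x. \<bar>V x\<bar> \<le> B" using periodic_continuous_bounded[OF cont per] by blast
  note minS = min_Spec_P_d[where V=V, OF B]
  show "continuous_on (- \<rat>) (min_Spec_P_d V)"
    unfolding continuous_on_iff
  proof (intro ballI allI impI)
    fix h e :: real assume h: "h \<in> - \<rat>" and e: "0 < e"
    then have "e/2 > 0" by simp
    then obtain d where d: "d > 0" "\<And>h h' z. h' \<notin> \<rat> \<Longrightarrow> \<bar>h - h'\<bar> < d \<Longrightarrow> z \<in> Spec_P_d V h \<Longrightarrow>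
        \<exists>\<mu>\<in>Spec_P_d V h'. \<bar>\<mu> - z\<bar> \<le> e/2"
      using spectra_close[OF cont per] by metis
    have one: "min_Spec_P_d V k' \<le> min_Spec_P_d V k + e/2" if k': "k' \<notin> \<rat>" "\<bar>k - k'\<bar> < d" for k k'
    proof -
      obtain \<mu> where "\<mu> \<in> Spec_P_d V k'" "\<bar>\<mu> - min_Spec_P_d V k\<bar> \<le> e/2"
        using d(2)[OF k' minS(1)] by blast
      then show ?thesis using minS(2)[of \<mu> k'] by linarith
    qed
    have "dist (min_Spec_P_d V k) (min_Spec_P_d V h) < e" if k: "k \<in> - \<rat>" "dist k h < d" for k
      using one[of k h] one[of h k] h k e by (auto simp: dist_real_def abs_minus_commute)
    then show "\<exists>d>0. \<forall>k\<in>- \<rat>. dist k h < d \<longrightarrow> dist (min_Spec_P_d V k) (min_Spec_P_d V h) < e"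
      using d(1) by blast
  qed
  show "hausdorff_continuous_on (- \<rat>) (Spec_P_d V)"
    unfolding hausdorff_continuous_on_def
  proof
    fix h :: real assume h: "h \<in> - \<rat>"
    show "((\<lambda>k. hausdorff_dist (Spec_P_d V k) (Spec_P_d V h)) \<longlongrightarrow> 0) (at h within - \<rat>)"
    proof (rule tendstoI)
      fix e :: real assume e: "e > 0"
      then have "e/2 > 0" by simp
      then obtain d where d: "d > 0" "\<And>h h' z. h' \<notin> \<rat> \<Longrightarrow> \<bar>h - h'\<bar> < d \<Longrightarrow> z \<in> Spec_P_d V h \<Longrightarrow>
          \<exists>\<mu>\<in>Spec_P_d V h'. \<bar>\<mu> - z\<bar> \<le> e/2"
        using spectra_close[OF cont per] by metis
      have "dist (hausdorff_dist (Spec_P_d V k) (Spec_P_d V h)) 0 < e"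
        if k: "k \<in> - \<rat>" "dist k h < d" for k
      proof -
        have kh: "\<bar>k - h\<bar> < d" "\<bar>h - k\<bar> < d" using k by (auto simp: dist_real_def)
        note H = hausdorff_dist_le[OF Spec_P_d_nonempty[where V=V, OF B] Spec_P_d_nonempty[where V=V, OF B]
            d(2)[OF _ kh(1)] d(2)[OF _ kh(2)]]
        show ?thesis using H h k e by (simp add: dist_real_def)
      qed
      then show "\<forall>\<^sub>F k in at h within - \<rat>. dist (hausdorff_dist (Spec_P_d V k) (Spec_P_d V h)) 0 < e"
        unfolding eventually_at using d(1) by blast
    qed
  qed
qed

section \<open>Discontinuity at \<open>h = 0\<close>\<close>

text \<open>At \<open>h = 0\<close> the potential is the constant \<open>4\<close>, so the spectrum lies in \<open>[4, 8]\<close>. For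
  \<open>h = 1/(2n)\<close> the potential takes the value \<open>-4\<close> at the site \<open>n\<close>, which puts spectrum within
  \<open>2\<close> of \<open>-2\<close>.\<close>

lemma cosine_spectrum:
  defines "V \<equiv> \<lambda>x. 4 * cos (2 * pi * x)"
  shows "z \<in> Spec_P_d V 0 \<Longrightarrow> 4 \<le> z"
    and "n > 0 \<Longrightarrow> \<exists>z\<in>Spec_P_d V (1 / (2 * real n)). z \<le> 0"
proof -
  have V: "\<bar>V x\<bar> \<le> 4" for x using abs_cos_le_one[of "2 * pi * x"] by (simp add: V_def abs_mult)
  show "4 \<le> z" if "z \<in> Spec_P_d V 0"
  proof -
    have "norm (schroedinger (sampled V 0) u - (2 + 4) *\<^sub>R u) \<le> (2 + 0) * norm u" for u
      by (rule norm_schroedinger) (simp add: V_def)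
    from real_spectrum_bounded[OF this] that show ?thesis
      unfolding Spec_P_d_eq_real_spectrum[OF V] by fastforce
  qed
  show "\<exists>z\<in>Spec_P_d V (1 / (2 * real n)). z \<le> 0" if n: "n > 0"
  proof -
    let ?W = "sampled V (1 / (2 * real n))" and ?u = "unit_ell2 (int n)"
    have Wn: "?W (int n) = - 4" using n by (simp add: V_def)
    have "schroedinger ?W ?u - (-2) *\<^sub>R ?u = - translate 1 ?u - translate (-1) ?u"
    proof (rule ell2_eqI)
      fix \<gamma>
      have "?W \<gamma> *\<^sub>R coord ?u \<gamma> = (-4) *\<^sub>R coord ?u \<gamma>"
        using Wn by (cases "\<gamma> = int n") (simp_all add: unit_ell2.rep_eq)
      then show "coord (schroedinger ?W ?u - (-2) *\<^sub>R ?u) \<gamma> =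
          coord (- translate 1 ?u - translate (-1) ?u) \<gamma>"
        unfolding coord_simps coord_schroedinger[OF V] translate.rep_eq
        by (simp add: scaleR_conv_of_real)
    qed
    then have "norm (schroedinger ?W ?u - (-2) *\<^sub>R ?u) \<le> 2 * norm ?u"
      using norm_triangle_ineq4[of "- translate 1 ?u" "translate (-1) ?u"] by simp
    then obtain z where "z \<in> real_spectrum (schroedinger ?W)" "\<bar>z - (-2)\<bar> \<le> 2"
      by (rule real_spectrum_near[OF bounded_linear_schroedinger[OF V] schroedinger_inner[OF V]
            unit_ell2_nonzero])
    then show ?thesis
      unfolding Spec_P_d_eq_real_spectrum[OF V] by (intro bexI[of _ z]) auto
  qed
qed

text \<open>Along \<open>h = 1/(2n)\<close> the minimum of the spectrum stays at or below \<open>0\<close> although it is at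
  least \<open>4\<close> in the limit; the same points keep the Hausdorff distance at least \<open>4\<close>.\<close>

lemma discontinuity_at_zero:
  obtains V where "C1_periodic V" "\<not> continuous_on UNIV (min_Spec_P_d V)"
    "\<not> hausdorff_continuous_on UNIV (Spec_P_d V)"
proof
  define V :: "real \<Rightarrow> real" where "V x = 4 * cos (2 * pi * x)" for x
  have V: "\<bar>V x\<bar> \<le> 4" for x using abs_cos_le_one[of "2 * pi * x"] by (simp add: V_def abs_mult)
  note spec = cosine_spectrum[folded V_def]
  note minS = min_Spec_P_d[where V=V, OF V]
  show "C1_periodic V"
    unfolding C1_periodic_def C1_differentiable_on_def
  proof (intro conjI allI exI ballI)
    show "(V has_vector_derivative 4 * (- sin (2 * pi * x) * (2 * pi))) (at x)" for x
      unfolding V_def has_real_derivative_iff_has_vector_derivative[symmetric]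
      by (auto intro!: derivative_eq_intros)
    show "continuous_on UNIV (\<lambda>x. 4 * (- sin (2 * pi * x) * (2 * pi)))"
      by (intro continuous_intros)
    show "V (x + 1) = V x" for x by (simp add: V_def distrib_left)
  qed
  define h where "h n = 1 / (2 * real (Suc n))" for n
  have h: "h \<longlonglongrightarrow> 0" "h n \<noteq> 0" for n
  proof -
    have "(\<lambda>n. (1/2) * inverse (real (Suc n))) \<longlonglongrightarrow> (1/2) * 0"
      by (intro tendsto_mult tendsto_const LIMSEQ_inverse_real_of_nat)
    moreover have "h = (\<lambda>n. (1/2) * inverse (real (Suc n)))"
      unfolding h_def[abs_def] by (intro ext) (simp only: divide_inverse inverse_mult_distrib mult_1_left)
    ultimately show "h \<longlonglongrightarrow> 0" by (simp only: mult_zero_right)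
  qed (simp add: h_def)
  obtain z where z: "\<And>n. z n \<in> Spec_P_d V (h n)" "\<And>n. z n \<le> 0"
    using spec(2)[of "Suc n" for n] unfolding h_def[symmetric] by (metis zero_less_Suc)
  show "\<not> continuous_on UNIV (min_Spec_P_d V)"
  proof
    assume "continuous_on UNIV (min_Spec_P_d V)"
    then have "(\<lambda>n. min_Spec_P_d V (h n)) \<longlonglongrightarrow> min_Spec_P_d V 0"
      using h by (simp add: continuous_on_tendsto_compose[where s=UNIV])
    moreover have "min_Spec_P_d V (h n) \<le> 0" for n using minS(2)[OF z(1)[of n]] z(2)[of n] by simp
    ultimately have "min_Spec_P_d V 0 \<le> 0" by (intro LIMSEQ_le_const2) auto
    with spec(1)[OF minS(1)] show False by simp
  qed
  show "\<not> hausdorff_continuous_on UNIV (Spec_P_d V)"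
  proof
    assume "hausdorff_continuous_on UNIV (Spec_P_d V)"
    then have "((\<lambda>k. hausdorff_dist (Spec_P_d V k) (Spec_P_d V 0)) \<longlongrightarrow> 0) (at 0)"
      by (simp add: hausdorff_continuous_on_def)
    moreover have "filterlim h (at 0) sequentially"
      using h by (simp add: filterlim_at)
    ultimately have "(\<lambda>n. hausdorff_dist (Spec_P_d V (h n)) (Spec_P_d V 0)) \<longlonglongrightarrow> 0"
      by (rule filterlim_compose)
    moreover have "4 \<le> hausdorff_dist (Spec_P_d V (h n)) (Spec_P_d V 0)" for n
    proof -
      have "4 \<le> infdist (z n) (Spec_P_d V 0)"
        unfolding infdist_notempty[OF Spec_P_d_nonempty[where V=V, OF V]]
      proof (rule cINF_greatest[OF Spec_P_d_nonempty[where V=V, OF V]])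
        show "4 \<le> dist (z n) y" if "y \<in> Spec_P_d V 0" for y
          using spec(1)[OF that] z(2)[of n] by (simp add: dist_real_def)
      qed
      also have "\<dots> \<le> (SUP a\<in>Spec_P_d V (h n). infdist a (Spec_P_d V 0))"
      proof (rule cSUP_upper[OF z(1)])
        have "infdist a (Spec_P_d V 0) \<le> 12" if "a \<in> Spec_P_d V (h n)" for a
          using Spec_P_d_bounded[where V=V, OF V that] Spec_P_d_bounded[where V=V, OF V minS(1)[of 0]]
          by (intro infdist_le2[OF minS(1)[of 0]]) (auto simp: dist_real_def)
        then show "bdd_above ((\<lambda>a. infdist a (Spec_P_d V 0)) ` Spec_P_d V (h n))"
          by (intro bdd_aboveI[of _ 12]) auto
      qed
      also have "\<dots> \<le> hausdorff_dist (Spec_P_d V (h n)) (Spec_P_d V 0)"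
        by (simp add: hausdorff_dist_def)
      finally show ?thesis .
    qed
    ultimately have "(4::real) \<le> 0" by (intro LIMSEQ_le_const) auto
    then show False by simp
  qed
qed

theorem mainTheorem3:
  shows "(\<exists>V. C1_periodic V \<and>
            \<not> continuous_on (UNIV :: real set) (\<lambda>h. min_Spec_P_d V h) \<and>
            \<not> hausdorff_continuous_on (UNIV :: real set) (\<lambda>h. Spec_P_d V h))
       \<and> (\<forall>V. C1_periodic V \<longrightarrow>
            continuous_on (- \<rat> :: real set) (\<lambda>h. min_Spec_P_d V h) \<and>
            hausdorff_continuous_on (- \<rat> :: real set) (\<lambda>h. Spec_P_d V h))"
  using discontinuity_at_zero continuity_on_irrationals by metis

end
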